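(* Let $k_1,\dots,k_m$ be natural numbers and $k,r$ natural numbers such that $2r\le m$, $k+1\le\min_{1\le i\le r}k_i$ and $k-1\le\min_{r<i\le 2r}k_i$. Then $$\Delta\Big[\prod_{i=1}^mC_{2^{k_i}}\Big]\le \Delta\Big[\prod_{i=1}^{r}C_{2^{k_i-k-1}}\times\prod_{i=r+1}^{2r}C_{2^{k_i-k+1}}\times\prod_{i=2r+1}^mC_{2^{k_i}}\Big]\cdot 2^{kr}+\Delta\Big[\prod_{i=1}^rC_{2^{k_i-1}}\times\prod_{i=r+1}^mC_{2^{k_i}}\Big]-1$$ and $$\eth\Big[\prod_{i=1}^mC_{2^{k_i}}\Big]\le \eth\Big[\prod_{i=1}^{r}C_{2^{k_i-k-1}}\times\prod_{i=r+1}^{2r}C_{2^{k_i-k+1}}\times\prod_{i=2r+1}^mC_{2^{k_i}}\Big]+\frac{1}{\sqrt{2^r}}\cdot\eth\Big[\prod_{i=1}^rC_{2^{k_i-1}}\times\prod_{i=r+1}^mC_{2^{k_i}}\Big]-\prod_{i=1}^m\frac{1}{\sqrt{2^{k_i}}}.$$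
   Context: For a subset $A$ of a group $G$, a subset $B\subseteq G$ is a difference basis for $A$ if every $a\in A$ can be written as $a=xy^{-1}$ with $x,y\in B$. The difference size $\Delta[A]$ is the smallest cardinality of a difference basis for $A$, and $\eth[A]=\Delta[A]/\sqrt{|A|}$. $C_n$ is the cyclic group of order $n$; $C_{2^0}$ is trivial. *)

theory Defs
  imports Complex_Main "HOL-Algebra.Product_Groups" "HOL-Algebra.Elementary_Groups"
begin

definition difference_basis :: "('a, 'b) monoid_scheme \<Rightarrow> 'a set \<Rightarrow> 'a set \<Rightarrow> bool" where
  "difference_basis G A B \<longleftrightarrow>
     B \<subseteq> carrier G \<and> (\<forall>a\<in>A. \<exists>x\<in>B. \<exists>y\<in>B. a = x \<otimes>\<^bsub>G\<^esub> inv\<^bsub>G\<^esub> y)"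

(* Only finite bases are considered, since card is 0 on infinite sets. For finite A a finite
   basis exists; the value is meaningless if A is infinite. *)
definition difference_size :: "('a, 'b) monoid_scheme \<Rightarrow> 'a set \<Rightarrow> nat" where
  "difference_size G A = (LEAST n. \<exists>B. finite B \<and> difference_basis G A B \<and> card B = n)"

definition difference_char :: "('a, 'b) monoid_scheme \<Rightarrow> 'a set \<Rightarrow> real" where
  "difference_char G A = real (difference_size G A) / sqrt (real (card A))"

abbreviation group_difference_size :: "('a, 'b) monoid_scheme \<Rightarrow> nat" where
  "group_difference_size G \<equiv> difference_size G (carrier G)"

abbreviation group_difference_char :: "('a, 'b) monoid_scheme \<Rightarrow> real" where
  "group_difference_char G \<equiv> difference_char G (carrier G)"

(* The direct product of the cyclic groups of order 2 ^ e i for i in I; a factor with e i = 0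
   is the trivial group, and so is the product over the empty set. *)
definition cyclic2_prod :: "nat set \<Rightarrow> (nat \<Rightarrow> nat) \<Rightarrow> (nat \<Rightarrow> int) monoid" where
  "cyclic2_prod I e = product_group I (\<lambda>i. integer_mod_group (2 ^ e i))"

end

theory Submission
  imports Defs "HOL-Algebra.Algebraic_Closure_Type" "HOL-Library.Z2" "HOL-Number_Theory.Cong"
begin

text \<open>
  Let \<open>H\<close> be the subgroup of index \<open>2\<^sup>r\<close> of elements whose first \<open>r\<close> coordinates are even, and let
  \<open>M\<close> be the subgroup of multiples of \<open>2\<^sup>k\<^sup>+\<^sup>1\<close> in the first \<open>r\<close> coordinates and of \<open>2\<^sup>k\<^sup>-\<^sup>1\<close> in the
  next \<open>r\<close>. If \<open>S\<close> is a set whose differences cover, modulo \<open>M\<close>, everything outside \<open>H\<close>, then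
  the sum of \<open>S\<close> and a difference basis of \<open>M\<close>, united with a translate of a difference basis
  of \<open>H\<close>, is a difference basis of the whole group.

  A set \<open>S\<close> with \<open>2\<^sup>k\<^sup>r\<close> elements comes from the field \<open>K\<close> with \<open>2\<^sup>r\<close> elements. Modulo 4, the
  Teichmueller vectors \<open>t\<^sub>\<alpha>\<close> have the property that every vector that is nonzero modulo 2 is a
  difference \<open>t\<^sub>\<alpha> - t\<^sub>\<beta>\<close> with \<open>\<alpha> \<noteq> \<beta>\<close>. The remaining freedom is absorbed by lines with
  different slopes: \<open>S\<close> consists of the points \<open>(t\<^sub>\<alpha> + 4 \<alpha> v, v)\<close>, and \<open>v \<mapsto> (\<alpha> - \<beta>) v\<close> is
  surjective because \<open>\<alpha> - \<beta>\<close> is a unit.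
\<close>

section \<open>Finite fields of characteristic two\<close>

text \<open>The field with \<open>2 ^ r\<close> elements is kept as a subset of a larger field, so
  that no type has to depend on \<open>r\<close>. \<open>sqrt_mem\<close> expresses surjectivity of
  Frobenius on \<open>K\<close>.\<close>

locale binary_subfield =
  fixes K :: "'a::field set" and r :: nat
  assumes two_eq_0: "(2::'a) = 0"
    and card_K: "card K = 2 ^ r"
    and zero_mem: "0 \<in> K"
    and one_mem: "1 \<in> K"
    and add_mem: "x \<in> K \<Longrightarrow> y \<in> K \<Longrightarrow> x + y \<in> K"
    and mult_mem: "x \<in> K \<Longrightarrow> y \<in> K \<Longrightarrow> x * y \<in> K"
    and inverse_mem: "x \<in> K \<Longrightarrow> inverse x \<in> K"
    and sqrt_mem: "x \<in> K \<Longrightarrow> \<exists>y\<in>K. y\<^sup>2 = x"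
begin

lemma double_eq_0: "x + x = (0::'a)"
  using two_eq_0 by (metis mult_2 mult_zero_left)

lemma uminus_eq: "- x = (x::'a)"
  using double_eq_0[of x] by (simp add: eq_neg_iff_add_eq_0 minus_equation_iff)

lemma of_int_eq: "(of_int n :: 'a) = (if even n then 0 else 1)"
proof (cases "even n")
  case True
  then obtain l where "n = 2 * l" by (elim evenE)
  then show ?thesis using two_eq_0 by simp
next
  case False
  then obtain l where "n = 2 * l + 1" by (elim oddE)
  then show ?thesis using two_eq_0 by simp
qed

lemma finite_K: "finite K"
  by (rule card_ge_0_finite) (simp add: card_K)

lemma of_int_mult_mem: "x \<in> K \<Longrightarrow> of_int n * x \<in> K"
  by (simp add: of_int_eq zero_mem)

lemma sum_mem: "(\<And>i. i \<in> A \<Longrightarrow> f i \<in> K) \<Longrightarrow> sum f A \<in> K"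
  by (induction A rule: infinite_finite_induct) (auto simp: zero_mem add_mem)

text \<open>Greedy choice: \<open>s\<close> elements have at most \<open>2 ^ s\<close> combinations,
  fewer than \<open>card K\<close> while \<open>s < r\<close>, so some element of \<open>K\<close>
  lies outside their span and can be appended.\<close>

lemma exists_independent:
  "s \<le> r \<Longrightarrow> \<exists>b::nat \<Rightarrow> 'a. (\<forall>i\<in>{1..s}. b i \<in> K) \<and>
     (\<forall>u. (\<Sum>i = 1..s. of_int (u i) * b i) = 0 \<longrightarrow> (\<forall>i\<in>{1..s}. even (u i)))"
proof (induction s)
  case 0
  then show ?case by simp
next
  case (Suc s)
  then obtain b :: "nat \<Rightarrow> 'a" where b: "\<forall>i\<in>{1..s}. b i \<in> K"
    and indep: "\<And>u. (\<Sum>i = 1..s. of_int (u i) * b i) = 0 \<Longrightarrow> \<forall>i\<in>{1..s}. even (u i)"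
    by auto
  let ?val = "\<lambda>u. \<Sum>i = 1..s. of_int (u i) * b i"
  let ?C = "PiE {1..s} (\<lambda>_. {0, 1::int})"
  \<comment> \<open>Coefficients act only through their parity, so the infinitely many integer
    vectors give no more values than the 0/1 vectors.\<close>
  have range: "range ?val \<subseteq> ?val ` ?C"
  proof (rule image_subsetI)
    fix u :: "nat \<Rightarrow> int"
    have "?val u = ?val (restrict (\<lambda>i. u i mod 2) {1..s})"
      by (rule sum.cong) (auto simp: of_int_eq)
    moreover have "restrict (\<lambda>i. u i mod 2) {1..s} \<in> ?C"
      by auto
    ultimately show "?val u \<in> ?val ` ?C" by blast
  qed
  have fin: "finite ?C" by (intro finite_PiE) auto
  have "card (?val ` ?C) \<le> card ?C" by (rule card_image_le[OF fin])
  also have "card ?C = 2 ^ s" by (simp add: card_PiE numeral_2_eq_2)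
  also have "\<dots> < card K" using Suc.prems by (simp add: card_K)
  finally have "\<not> K \<subseteq> ?val ` ?C"
    using fin by (meson card_mono finite_imageI not_le)
  then obtain c where c: "c \<in> K" "\<And>u. c \<noteq> ?val u" using range by blast
  have "(\<forall>i\<in>{1..Suc s}. (b(Suc s := c)) i \<in> K)"
    using b c by auto
  moreover have "\<forall>i\<in>{1..Suc s}. even (u i)"
    if u: "(\<Sum>i = 1..Suc s. of_int (u i) * (b(Suc s := c)) i) = 0" for u
  proof -
    have eq: "?val u + of_int (u (Suc s)) * c = 0" using u by simp
    have ev: "even (u (Suc s))"
    proof (rule ccontr)
      assume "odd (u (Suc s))"
      then have "?val u + c = 0" using eq by (simp add: of_int_eq)
      then have "c = ?val u" by (metis uminus_eq add_eq_0_iff)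
      then show False using c by blast
    qed
    then have "?val u = 0" using eq by (simp add: of_int_eq)
    then show ?thesis using indep ev by (auto simp: le_Suc_eq)
  qed
  ultimately show ?case by blast
qed

end

text \<open>\<open>K\<close> is the root set of \<open>X ^ q - X\<close> with
  \<open>q = 2 ^ r\<close> in an algebraic closure of the two-element field; Frobenius makes it
  closed under addition. For \<open>r = 0\<close> this polynomial would vanish.\<close>

lemma exists_binary_subfield:
  assumes "r > 0"
  shows "\<exists>K :: bit alg_closure set. binary_subfield K r"
proof -
  define q :: nat where "q = 2 ^ r"
  have two: "(2 :: bit alg_closure) = 0"
    using to_ac_numeral[where 'a = bit, of "Num.Bit0 Num.One"] by simp
  have q1: "q > 1" using assms unfolding q_def by (rule one_less_power[rotated]) simp
  have q2: "q = 2 * 2 ^ (r - 1)" using assms by (cases r) (auto simp: q_def)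
  have frob: "(x + y) ^ 2 ^ n = x ^ 2 ^ n + y ^ 2 ^ n" for x y :: "bit alg_closure" and n
    by (induction n) (simp_all add: power_mult power2_sum two mult.commute[of 2])
  define K where "K = {x :: bit alg_closure. x ^ q = x}"
  define p :: "bit alg_closure Polynomial.poly" where "p = Polynomial.monom 1 q - [:0, 1:]"
  have deg: "Polynomial.degree p = q"
    using degree_add_eq_left[of "- [:0, 1:]" "Polynomial.monom (1 :: bit alg_closure) q"] q1
    by (simp only: p_def diff_conv_add_uminus) (simp add: Polynomial.degree_monom_eq)
  then have p0: "p \<noteq> 0" using q1 by auto
  have poly_p: "Polynomial.poly p x = x ^ q - x" for x
    by (simp add: p_def poly_monom)
  have "of_nat q = (0 :: bit alg_closure)" using q2 two by simp
  then have pd: "Polynomial.pderiv p = [:-1:]"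
    by (simp add: p_def pderiv_diff pderiv_monom pderiv_pCons)
  \<comment> \<open>Roots are simple because the derivative is the constant -1; hence there are
    exactly \<open>q\<close> distinct roots.\<close>
  have order_1: "Polynomial.order x p = 1" if root: "Polynomial.poly p x = 0" for x
  proof -
    obtain g where g: "p = [:-x, 1:] * g" using root by (auto simp: poly_eq_0_iff_dvd elim: dvdE)
    have "Polynomial.poly (Polynomial.pderiv p) x = Polynomial.poly g x"
      unfolding g pderiv_mult by (simp add: pderiv_pCons)
    then have "Polynomial.poly g x = - 1" by (simp add: pd)
    then have "Polynomial.poly g x \<noteq> 0" by (metis neg_equal_0_iff_equal zero_neq_one)
    then have "Polynomial.order x g = 0" by (rule order_0I)
    moreover have "Polynomial.order x [:-x, 1:] = 1"
      using order_power_n_n[of x 1] by simp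
    ultimately show ?thesis
      using p0 unfolding g by (simp add: Polynomial.order_mult del: mult_pCons_left)
  qed
  obtain A where A: "size A = Polynomial.degree p"
    "p = Polynomial.smult (Polynomial.lead_coeff p) (\<Prod>x\<in>#A. [:-x, 1:])"
    using alg_closed_imp_factorization[OF p0] by blast
  have "proots p = proots (\<Prod>x\<in>#A. [:-x, 1:])"
    by (subst A(2)) (use p0 in simp)
  also have "\<dots> = A"
  proof (induction A)
    case (add x A)
    have "(\<Prod>x\<in>#A. [:-x, 1:]) \<noteq> 0" by (auto simp: prod_mset_zero_iff)
    then show ?case using add by (simp add: proots_mult del: mult_pCons_left)
  qed simp
  finally have size: "size (proots p) = q" using A deg by simp
  have setp: "set_mset (proots p) = K"
    using p0 by (auto simp: K_def poly_p)
  have "size (proots p) = (\<Sum>x\<in>K. count (proots p) x)"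
    by (simp add: size_multiset_overloaded_eq setp)
  also have "\<dots> = (\<Sum>x\<in>K. 1)"
  proof (rule sum.cong)
    fix x assume "x \<in> K"
    then show "count (proots p) x = 1"
      using order_1[of x] p0 by (simp add: K_def poly_p)
  qed simp
  finally have "card K = 2 ^ r" using size by (simp add: q_def)
  moreover have "x + y \<in> K" if "x \<in> K" "y \<in> K" for x y
    using that by (simp add: K_def q_def frob)
  \<comment> \<open>Squaring \<open>x ^ 2 ^ (r - 1)\<close> gives \<open>x ^ q\<close>, which equals
    \<open>x\<close> on \<open>K\<close>.\<close>
  moreover have "\<exists>y\<in>K. y\<^sup>2 = x" if x: "x \<in> K" for x
  proof (rule bexI)
    show "(x ^ 2 ^ (r - 1))\<^sup>2 = x"
      using x by (simp add: K_def q2 mult.commute flip: power_mult)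
    show "x ^ 2 ^ (r - 1) \<in> K"
      using x by (simp add: K_def) (metis mult.commute power_mult)
  qed
  ultimately have "binary_subfield K r"
    using two q1
    by unfold_locales (auto simp: K_def power_mult_distrib power_inverse)
  then show ?thesis by blast
qed

text \<open>\<open>b\<close> is a basis of \<open>K\<close> over the two-element field. Coefficients
  are integers and independence is meant modulo 2, so that vectors considered modulo higher powers
  of 2 fit the same setting.\<close>

locale binary_basis = binary_subfield K r for K :: "'a::field set" and r +
  fixes b :: "nat \<Rightarrow> 'a"
  assumes basis_mem: "i \<in> {1..r} \<Longrightarrow> b i \<in> K"
    and indep: "(\<Sum>i = 1..r. of_int (u i) * b i) = 0 \<Longrightarrow> i \<in> {1..r} \<Longrightarrow> even (u i)"
begin

definition val :: "(nat \<Rightarrow> int) \<Rightarrow> 'a" where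
  "val u = (\<Sum>i = 1..r. of_int (u i) * b i)"

lemma val_mem: "val u \<in> K"
  unfolding val_def by (intro sum_mem of_int_mult_mem basis_mem)

lemma val_add: "val (\<lambda>i. u i + v i) = val u + val v"
  by (simp add: val_def sum.distrib ring_distribs)

lemma val_diff: "val (\<lambda>i. u i - v i) = val u - val v"
  by (simp add: val_def sum_subtractf ring_distribs)

lemma val_zero_iff: "val u = 0 \<longleftrightarrow> (\<forall>i\<in>{1..r}. even (u i))"
proof
  show "val u = 0 \<Longrightarrow> \<forall>i\<in>{1..r}. even (u i)"
    using indep by (auto simp: val_def)
qed (simp add: val_def of_int_eq)

lemma val_double: "val (\<lambda>i. 2 * u i) = 0"
  by (simp add: val_zero_iff)

text \<open>Counting: independence makes \<open>val\<close> injective on the \<open>2 ^ r\<close>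
  vectors with entries 0 and 1, and \<open>K\<close> has just as many elements.\<close>

lemma val_surj:
  assumes "x \<in> K"
  shows "\<exists>u. val u = x"
proof -
  let ?C = "PiE {1..r} (\<lambda>_. {0, 1::int})"
  have "inj_on val ?C"
  proof (rule inj_onI)
    fix u v assume u: "u \<in> ?C" and v: "v \<in> ?C" and "val u = val v"
    then have "val (\<lambda>i. u i - v i) = 0" by (simp add: val_diff)
    then have *: "\<forall>i\<in>{1..r}. even (u i - v i)" by (simp add: val_zero_iff)
    show "u = v"
    proof (rule PiE_ext[OF u v])
      fix i assume i: "i \<in> {1..r}"
      have "u i \<in> {0, 1}" "v i \<in> {0, 1}" using PiE_mem[OF u i] PiE_mem[OF v i] by auto
      moreover have "even (u i - v i)" using * i by blast
      ultimately show "u i = v i" by auto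
    qed
  qed
  then have "card (val ` ?C) = card K"
    by (simp add: card_image card_PiE card_K numeral_2_eq_2)
  moreover have "val ` ?C \<subseteq> K" using val_mem by blast
  ultimately have "val ` ?C = K" using finite_K by (metis card_subset_eq)
  then show ?thesis using assms by blast
qed

end

section \<open>A relative difference set from Witt vectors\<close>

text \<open>The Vandermonde identity for binomial coefficients over 2; it supplies the diagonal
  terms in \<open>ghost_add\<close>.\<close>

lemma int_binomial2_add:
  fixes x y :: int
  shows "(x + y) * (x + y - 1) div 2 = x * (x - 1) div 2 + y * (y - 1) div 2 + x * y"
proof -
  have "even (x * (x - 1))" "even (y * (y - 1))" by auto
  then obtain c d where c: "x * (x - 1) = 2 * c" and d: "y * (y - 1) = 2 * d"
    by (meson dvdE)
  have "(x + y) * (x + y - 1) = x * (x - 1) + y * (y - 1) + 2 * (x * y)"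
    by (simp add: algebra_simps)
  then have "(x + y) * (x + y - 1) = 2 * (c + d + x * y)"
    using c d by simp
  then show ?thesis using c d by simp
qed

context binary_basis
begin

text \<open>
  The second Witt component: formally \<open>ghost x = ((\<Sum> x\<^sub>i b\<^sub>i)\<^sup>2 - \<Sum> x\<^sub>i b\<^sub>i\<^sup>2) / 2\<close>. The pair
  \<open>(val, ghost)\<close> is a homomorphism from integer vectors to the length-two Witt vectors
  over \<open>K\<close>, with kernel the vectors divisible by 4.
\<close>
definition ghost :: "(nat \<Rightarrow> int) \<Rightarrow> 'a" where
  "ghost x = (\<Sum>j = 1..r. (\<Sum>i = 1..<j. of_int (x i) * b i) * (of_int (x j) * b j)
                       + of_int (x j * (x j - 1) div 2) * (b j)\<^sup>2)"

lemma ghost_mem: "ghost x \<in> K"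
  unfolding ghost_def power2_eq_square
  by (intro sum_mem add_mem mult_mem of_int_mult_mem basis_mem) auto

lemma ghost_cong: "(\<And>i. i \<in> {1..r} \<Longrightarrow> x i = y i) \<Longrightarrow> ghost x = ghost y"
  unfolding ghost_def by (intro sum.cong refl arg_cong2[where f = "(+)"] arg_cong2[where f = "(*)"]) auto

text \<open>Formally this is half of the cross term in the square of a sum. Since 2 is not
  invertible in \<open>K\<close>, the identity is checked by adding one coordinate at a
  time.\<close>

lemma ghost_add: "ghost (\<lambda>i. x i + y i) = ghost x + ghost y + val x * val y"
proof -
  define F where "F = (\<lambda>x j. (\<Sum>i = 1..<j. of_int (x i) * b i) * (of_int (x j) * b j)
                       + of_int (x j * (x j - 1) div 2) * (b j)\<^sup>2)"
  have "(\<Sum>j = 1..n. F (\<lambda>i. x i + y i) j) = (\<Sum>j = 1..n. F x j) + (\<Sum>j = 1..n. F y j)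
          + (\<Sum>i = 1..n. of_int (x i) * b i) * (\<Sum>i = 1..n. of_int (y i) * b i)" for n
  proof (induction n)
    case 0
    then show ?case by simp
  next
    case (Suc n)
    let ?X = "\<Sum>i = 1..n. of_int (x i) * b i"
    let ?Y = "\<Sum>i = 1..n. of_int (y i) * b i"
    let ?c = "b (Suc n)"
    have *: "{1..<Suc n} = {1..n}" by auto
    have "F (\<lambda>i. x i + y i) (Suc n) = F x (Suc n) + F y (Suc n)
            + ?X * (of_int (y (Suc n)) * ?c) + (of_int (x (Suc n)) * ?c) * ?Y
            + (of_int (x (Suc n)) * ?c) * (of_int (y (Suc n)) * ?c)"
      unfolding F_def int_binomial2_add *
      by (simp add: sum.distrib ring_distribs power2_eq_square mult_ac add_ac)
    then show ?case using Suc.IH by (simp add: ring_distribs add_ac)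
  qed
  from this[of r] show ?thesis unfolding ghost_def val_def F_def .
qed

lemma sum_square: "finite A \<Longrightarrow> (\<Sum>i\<in>A. f i)\<^sup>2 = (\<Sum>i\<in>A. (f i :: 'a)\<^sup>2)"
  by (induction A rule: finite_induct) (auto simp: power2_sum two_eq_0)

text \<open>The mixed terms vanish in characteristic two, and
  \<open>2 * y * (2 * y - 1) div 2\<close> has the parity of \<open>y\<close>. What remains is a sum
  of squares, hence the square of the sum.\<close>

lemma ghost_double: "ghost (\<lambda>i. 2 * y i) = (val y)\<^sup>2"
proof -
  have "ghost (\<lambda>i. 2 * y i) = (\<Sum>j = 1..r. of_int (y j) * (b j)\<^sup>2)"
    unfolding ghost_def
  proof (rule sum.cong)
    fix j
    have "2 * y j * (2 * y j - 1) div 2 = y j * (2 * y j - 1)" by simp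
    moreover have "(of_int (y j * (2 * y j - 1)) :: 'a) = of_int (y j)"
      unfolding of_int_eq by simp
    ultimately show "(\<Sum>i = 1..<j. of_int (2 * y i) * b i) * (of_int (2 * y j) * b j)
        + of_int (2 * y j * (2 * y j - 1) div 2) * (b j)\<^sup>2 = of_int (y j) * (b j)\<^sup>2"
      by (simp add: two_eq_0)
  qed simp
  also have "\<dots> = (\<Sum>j = 1..r. (of_int (y j) * b j)\<^sup>2)"
    by (intro sum.cong) (auto simp: of_int_eq)
  finally show ?thesis by (simp add: val_def sum_square)
qed

text \<open>Two successive halvings of the difference: equal \<open>val\<close> makes it
  \<open>2 * w\<close>, and then equal \<open>ghost\<close> gives
  \<open>(val w)\<^sup>2 = 0\<close>, so \<open>w\<close> is even as well.\<close>

lemma cong_4_if_val_ghost_eq: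
  assumes "val x = val y" "ghost x = ghost y" and i: "i \<in> {1..r}"
  shows "[x i = y i] (mod 4)"
proof -
  define z where "z = (\<lambda>i. x i - y i)"
  define w where "w = (\<lambda>i. z i div 2)"
  have vz: "val z = 0" using assms by (simp add: z_def val_diff)
  then have zw: "z i = 2 * w i" if "i \<in> {1..r}" for i
    using that by (auto simp: val_zero_iff w_def)
  have "ghost x = ghost (\<lambda>i. y i + z i)" by (simp add: z_def)
  then have "ghost z = 0" using vz assms by (simp add: ghost_add)
  also have "ghost z = ghost (\<lambda>i. 2 * w i)" by (intro ghost_cong zw)
  finally have "val w = 0" by (simp add: ghost_double)
  then have "even (w i)" using i by (simp add: val_zero_iff)
  then have "4 dvd z i" using zw[OF i] by auto
  then show ?thesis by (simp add: cong_iff_dvd_diff z_def)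
qed

text \<open>Adding \<open>2 * y\<close> preserves \<open>val\<close> and changes
  \<open>ghost\<close> by \<open>(val y)\<^sup>2\<close>; a square root of \<open>ghost x\<close> in
  \<open>K\<close> therefore cancels the second component.\<close>

lemma exists_teichmueller:
  assumes "\<alpha> \<in> K"
  shows "\<exists>t. val t = \<alpha> \<and> ghost t = 0"
proof -
  obtain x where x: "val x = \<alpha>" using val_surj assms by blast
  obtain c where c: "c \<in> K" "c\<^sup>2 = ghost x" using sqrt_mem ghost_mem by blast
  obtain y where y: "val y = c" using val_surj c by blast
  have "ghost (\<lambda>i. x i + 2 * y i) = 0"
    by (simp add: ghost_add ghost_double y c val_double double_eq_0)
  moreover have "val (\<lambda>i. x i + 2 * y i) = \<alpha>"
    by (simp add: val_add val_double x)
  ultimately show ?thesis by blast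
qed

definition teich :: "'a \<Rightarrow> nat \<Rightarrow> int" where
  "teich \<alpha> = (SOME t. val t = \<alpha> \<and> ghost t = 0)"

lemma teich: "\<alpha> \<in> K \<Longrightarrow> val (teich \<alpha>) = \<alpha>" "\<alpha> \<in> K \<Longrightarrow> ghost (teich \<alpha>) = 0"
  using someI_ex[OF exists_teichmueller] by (auto simp: teich_def)

text \<open>The vector \<open>a + teich \<beta>\<close> is a Teichmueller vector modulo 4 once its
  \<open>ghost\<close>, which is \<open>ghost a + val a * \<beta>\<close>, vanishes. This linear
  equation determines \<beta>, and \<alpha> is then forced by \<open>val\<close>.\<close>

lemma exists_teich_diff:
  assumes "val a \<noteq> 0"
  shows "\<exists>\<alpha>\<in>K. \<exists>\<beta>\<in>K. \<alpha> \<noteq> \<beta> \<and> (\<forall>i\<in>{1..r}. [a i = teich \<alpha> i - teich \<beta> i] (mod 4))"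
proof -
  define \<beta> where "\<beta> = ghost a * inverse (val a)"
  define \<alpha> where "\<alpha> = val a + \<beta>"
  have mem: "\<beta> \<in> K" "\<alpha> \<in> K"
    by (simp_all add: \<alpha>_def \<beta>_def add_mem mult_mem ghost_mem val_mem inverse_mem)
  have "ghost (\<lambda>i. a i + teich \<beta> i) = ghost a + val a * \<beta>"
    by (simp add: ghost_add teich mem)
  also have "\<dots> = 0" using assms double_eq_0[of "ghost a"] by (simp add: \<beta>_def field_simps)
  finally have g: "ghost (\<lambda>i. a i + teich \<beta> i) = ghost (teich \<alpha>)"
    by (simp add: teich mem)
  have v: "val (\<lambda>i. a i + teich \<beta> i) = val (teich \<alpha>)"
    using teich(1)[OF mem(2)] teich(1)[OF mem(1)] by (simp add: val_add) (simp add: \<alpha>_def)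
  have "[a i = teich \<alpha> i - teich \<beta> i] (mod 4)" if "i \<in> {1..r}" for i
    using cong_4_if_val_ghost_eq[OF v g that] by (simp add: cong_iff_dvd_diff algebra_simps)
  then show ?thesis using mem assms by (intro bexI[of _ \<alpha>] bexI[of _ \<beta>]) (auto simp: \<alpha>_def)
qed

text \<open>
  An integer matrix that represents multiplication by \<open>\<alpha>\<close> modulo 2. Differences of two such
  matrices are invertible modulo 2, hence modulo every power of 2.
\<close>
definition mult_vec :: "'a \<Rightarrow> (nat \<Rightarrow> int) \<Rightarrow> nat \<Rightarrow> int" where
  "mult_vec \<alpha> v i = (\<Sum>j = 1..r. v j * (SOME u. val u = \<alpha> * b j) i)"

lemma val_scale: "val (\<lambda>i. c * u i) = of_int c * val u"
  by (simp add: val_def sum_distrib_left mult_ac)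

lemma val_sum: "val (\<lambda>i. \<Sum>j\<in>A. f j i) = (\<Sum>j\<in>A. val (f j))"
  unfolding val_def by (simp add: sum_distrib_right) (rule sum.swap)

lemma val_mult_vec:
  assumes "\<alpha> \<in> K"
  shows "val (mult_vec \<alpha> v) = \<alpha> * val v"
proof -
  have *: "val (SOME u. val u = \<alpha> * b j) = \<alpha> * b j" if "j \<in> {1..r}" for j
    using someI_ex[OF val_surj[OF mult_mem[OF assms basis_mem[OF that]]]] .
  have "val (mult_vec \<alpha> v) = (\<Sum>j = 1..r. of_int (v j) * val (SOME u. val u = \<alpha> * b j))"
    unfolding mult_vec_def by (simp add: val_sum val_scale)
  also have "\<dots> = (\<Sum>j = 1..r. of_int (v j) * (\<alpha> * b j))"
    by (intro sum.cong) (simp_all add: *)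
  finally show ?thesis by (simp add: val_def sum_distrib_left mult_ac)
qed

lemma mult_vec_add: "mult_vec \<alpha> (\<lambda>i. u i + v i) i = mult_vec \<alpha> u i + mult_vec \<alpha> v i"
  by (simp add: mult_vec_def sum.distrib ring_distribs)

lemma mult_vec_diff_scale:
  "mult_vec \<alpha> (\<lambda>i. u i - c * v i) i = mult_vec \<alpha> u i - c * mult_vec \<alpha> v i"
  by (simp add: mult_vec_def sum_subtractf sum_distrib_left algebra_simps)

lemma mult_vec_cong:
  assumes "\<And>j. j \<in> {1..r} \<Longrightarrow> [u j = v j] (mod n)"
  shows "[mult_vec \<alpha> u i = mult_vec \<alpha> v i] (mod n)"
  unfolding mult_vec_def by (intro cong_sum cong_mult assms cong_refl)

text \<open>Hensel lifting: a solution modulo \<open>2 ^ n\<close> has error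
  \<open>2 ^ n * u\<close>, and the correction only requires solving a system modulo 2.\<close>

lemma mult_vec_diff_surj:
  assumes \<alpha>: "\<alpha> \<in> K" and \<beta>: "\<beta> \<in> K" and "\<alpha> \<noteq> \<beta>"
  shows "\<exists>v. \<forall>i\<in>{1..r}. [mult_vec \<alpha> v i - mult_vec \<beta> v i = w i] (mod 2 ^ n)"
proof (induction n)
  case 0
  then show ?case by simp
next
  case (Suc n)
  let ?M = "\<lambda>v i. mult_vec \<alpha> v i - mult_vec \<beta> v i"
  obtain v where v: "\<forall>i\<in>{1..r}. [?M v i = w i] (mod 2 ^ n)" using Suc by blast
  define u where "u = (\<lambda>i. (?M v i - w i) div 2 ^ n)"
  have u: "?M v i = w i + 2 ^ n * u i" if "i \<in> {1..r}" for i
    using v that by (auto simp: u_def cong_iff_dvd_diff)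
  have "\<alpha> - \<beta> \<in> K"
    using add_mem[OF \<alpha> \<beta>] uminus_eq[of \<beta>] by (metis add_uminus_conv_diff)
  \<comment> \<open>Modulo 2 the matrix is multiplication by \<open>\<alpha> - \<beta>\<close> on
    \<open>K\<close>, so the correction is found by division in the field.\<close>
  then obtain v1 where v1: "val v1 = val u * inverse (\<alpha> - \<beta>)"
    using val_surj mult_mem inverse_mem val_mem by blast
  have "val (\<lambda>i. ?M v1 i - u i) = \<alpha> * val v1 - \<beta> * val v1 - val u"
    by (simp add: val_diff val_mult_vec \<alpha> \<beta>)
  also have "\<dots> = 0"
    using \<open>\<alpha> \<noteq> \<beta>\<close> by (simp add: v1 flip: left_diff_distrib)
  finally have ev: "even (?M v1 i - u i)" if "i \<in> {1..r}" for i
    using that by (simp only: val_zero_iff)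
  have "[?M (\<lambda>i. v i - 2 ^ n * v1 i) i = w i] (mod 2 ^ Suc n)" if i: "i \<in> {1..r}" for i
  proof -
    have "?M (\<lambda>i. v i - 2 ^ n * v1 i) i - w i = (?M v i - w i) - 2 ^ n * ?M v1 i"
      unfolding mult_vec_diff_scale by (simp add: algebra_simps)
    also have "\<dots> = 2 ^ n * (- (?M v1 i - u i))"
      unfolding u[OF i] by (simp add: algebra_simps)
    finally have eq: "?M (\<lambda>i. v i - 2 ^ n * v1 i) i - w i = 2 ^ n * (- (?M v1 i - u i))" .
    have "even (- (?M v1 i - u i))" using ev[OF i] by simp
    then have "2 ^ n * 2 dvd 2 ^ n * (- (?M v1 i - u i))" by (rule mult_dvd_mono[OF dvd_refl])
    then show ?thesis unfolding cong_iff_dvd_diff eq by (simp add: mult.commute)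
  qed
  then show ?case by blast
qed

text \<open>
  For fixed \<open>\<alpha>\<close> these points form a coset of the subgroup \<open>{(4 \<alpha> v, v)}\<close>; two such subgroups
  of different slopes generate all pairs of integer vectors whose first component is divisible
  by 4, modulo \<open>2\<^sup>n\<^sup>+\<^sup>2\<close> in the first and \<open>2\<^sup>n\<close> in the second component.
\<close>
definition point :: "'a \<Rightarrow> (nat \<Rightarrow> int) \<Rightarrow> nat \<Rightarrow> int" where
  "point \<alpha> v = (\<lambda>i. if i \<in> {1..r} then teich \<alpha> i + 4 * mult_vec \<alpha> v i
                   else if i \<in> {r + 1..2 * r} then v (i - r) else 0)"

definition points :: "nat \<Rightarrow> (nat \<Rightarrow> int) set" where
  "points n = (\<lambda>(\<alpha>, v). point \<alpha> v) ` (K \<times> PiE {1..r} (\<lambda>_. {0..<2 ^ n}))"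

lemma finite_points: "finite (points n)"
  unfolding points_def by (intro finite_imageI finite_cartesian_product finite_K finite_PiE) auto

lemma card_points_le: "card (points n) \<le> 2 ^ (Suc n * r)"
proof -
  have "finite (K \<times> PiE {1..r} (\<lambda>_. {0..<2 ^ n :: int}))"
    by (intro finite_cartesian_product finite_K finite_PiE) auto
  then have "card (points n) \<le> card (K \<times> PiE {1..r} (\<lambda>_. {0..<2 ^ n :: int}))"
    unfolding points_def by (rule card_image_le)
  also have "\<dots> = 2 ^ (Suc n * r)"
    by (simp add: card_cartesian_product card_PiE card_K power_add power_mult nat_power_eq)
  finally show ?thesis .
qed

lemma points_nonempty: "points n \<noteq> {}"
  using zero_mem by (auto simp: points_def PiE_eq_empty_iff)

text \<open>The slopes \<alpha> and \<beta> are fixed by \<open>a\<close> modulo 4. The second block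
  prescribes the difference \<open>z\<close> of the two parameters; with parameters
  \<open>v + z\<close> and \<open>v\<close>, the first block becomes a linear equation for
  \<open>v\<close> with matrix \<open>mult_vec \<alpha> - mult_vec \<beta>\<close>.\<close>

lemma points_diff:
  assumes "i \<in> {1..r}" "odd (a i)"
  shows "\<exists>s\<in>points n. \<exists>s'\<in>points n.
           (\<forall>i\<in>{1..r}. [a i = s i - s' i] (mod 2 ^ (n + 2))) \<and>
           (\<forall>i\<in>{r + 1..2 * r}. [a i = s i - s' i] (mod 2 ^ n))"
proof -
  have "val a \<noteq> 0" using assms by (auto simp: val_zero_iff)
  then obtain \<alpha> \<beta> where \<alpha>: "\<alpha> \<in> K" and \<beta>: "\<beta> \<in> K" and ne: "\<alpha> \<noteq> \<beta>"
    and cong4: "\<And>i. i \<in> {1..r} \<Longrightarrow> [a i = teich \<alpha> i - teich \<beta> i] (mod 4)"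
    using exists_teich_diff by metis
  define w where "w = (\<lambda>i. (a i - (teich \<alpha> i - teich \<beta> i)) div 4)"
  have w: "a i = teich \<alpha> i - teich \<beta> i + 4 * w i" if "i \<in> {1..r}" for i
    using cong4[OF that] by (auto simp: w_def cong_iff_dvd_diff)
  define z where "z = (\<lambda>i. a (i + r))"
  obtain v where v: "\<And>i. i \<in> {1..r} \<Longrightarrow>
      [mult_vec \<alpha> v i - mult_vec \<beta> v i = w i - mult_vec \<alpha> z i] (mod 2 ^ n)"
    using mult_vec_diff_surj[OF \<alpha> \<beta> ne, of "\<lambda>i. w i - mult_vec \<alpha> z i" n] by blast
  define red where "red = (\<lambda>u. restrict (\<lambda>i. u i mod (2 ^ n :: int)) {1..r})"
  have red_mem: "red u \<in> PiE {1..r} (\<lambda>_. {0..<2 ^ n})" for u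
    by (auto simp: red_def)
  have red_cong: "[red u i = u i] (mod 2 ^ n)" if "i \<in> {1..r}" for u i
    using that by (simp add: red_def cong_def)
  define p where "p = red (\<lambda>i. v i + z i)"
  define q where "q = red v"
  show ?thesis
  proof (rule bexI[where x = "point \<alpha> p"], rule bexI[where x = "point \<beta> q"], intro conjI ballI)
    show "point \<alpha> p \<in> points n" "point \<beta> q \<in> points n"
      using \<alpha> \<beta> red_mem by (auto simp: points_def p_def q_def)
    fix i
    assume i: "i \<in> {1..r}"
    have "[mult_vec \<alpha> p i - mult_vec \<beta> q i
            = mult_vec \<alpha> (\<lambda>i. v i + z i) i - mult_vec \<beta> v i] (mod 2 ^ n)"
      unfolding p_def q_def by (intro cong_diff mult_vec_cong red_cong)
    also have "mult_vec \<alpha> (\<lambda>i. v i + z i) i - mult_vec \<beta> v i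
                 = (mult_vec \<alpha> v i - mult_vec \<beta> v i) + mult_vec \<alpha> z i"
      by (simp add: mult_vec_add)
    also have "[\<dots> = (w i - mult_vec \<alpha> z i) + mult_vec \<alpha> z i] (mod 2 ^ n)"
      by (intro cong_add v[OF i] cong_refl)
    finally have "2 ^ n dvd w i - (mult_vec \<alpha> p i - mult_vec \<beta> q i)"
      by (simp add: cong_iff_dvd_diff dvd_diff_commute)
    \<comment> \<open>The factor 4 in \<open>point\<close> raises the modulus from
      \<open>2 ^ n\<close> to \<open>2 ^ (n + 2)\<close>.\<close>
    then have "4 * 2 ^ n dvd 4 * (w i - (mult_vec \<alpha> p i - mult_vec \<beta> q i))"
      by (rule mult_dvd_mono[OF dvd_refl])
    also have "4 * (w i - (mult_vec \<alpha> p i - mult_vec \<beta> q i)) = a i - (point \<alpha> p i - point \<beta> q i)"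
      using i w[OF i] by (simp add: point_def algebra_simps)
    finally show "[a i = point \<alpha> p i - point \<beta> q i] (mod 2 ^ (n + 2))"
      by (simp add: cong_iff_dvd_diff)
  next
    fix i
    assume i: "i \<in> {r + 1..2 * r}"
    then have ir: "i - r \<in> {1..r}" "i \<notin> {1..r}" by auto
    have "[p (i - r) - q (i - r) = (v (i - r) + z (i - r)) - v (i - r)] (mod 2 ^ n)"
      unfolding p_def q_def by (intro cong_diff red_cong ir)
    moreover have "z (i - r) = a i" using i by (simp add: z_def)
    ultimately show "[a i = point \<alpha> p i - point \<beta> q i] (mod 2 ^ n)"
      using i ir by (simp add: point_def cong_sym_eq)
  qed
qed

end

text \<open>This form hides the field. It will be used with \<open>n = k - 1\<close>, where the
  moduli are \<open>2 ^ (k + 1)\<close> and \<open>2 ^ (k - 1)\<close> and the size bound is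
  \<open>2 ^ (k * r)\<close>.\<close>

lemma exists_relative_difference_set:
  "\<exists>S :: (nat \<Rightarrow> int) set. finite S \<and> S \<noteq> {} \<and> card S \<le> 2 ^ (Suc n * r) \<and>
     (\<forall>a. (\<exists>i\<in>{1..r}. odd (a i)) \<longrightarrow> (\<exists>s\<in>S. \<exists>s'\<in>S.
        (\<forall>i\<in>{1..r}. [a i = s i - s' i] (mod 2 ^ (n + 2))) \<and>
        (\<forall>i\<in>{r + 1..2 * r}. [a i = s i - s' i] (mod 2 ^ n))))"
proof (cases "r = 0")
  case True
  \<comment> \<open>No field has one element, but for \<open>r = 0\<close> the covering condition is
    vacuous and a singleton meets the bound 1.\<close>
  then show ?thesis by (intro exI[of _ "{\<lambda>_. 0}"]) auto
next
  case False
  then obtain K :: "bit alg_closure set" where "binary_subfield K r"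
    using exists_binary_subfield by auto
  then interpret binary_subfield K r .
  obtain b where b: "\<forall>i\<in>{1..r}. b i \<in> K"
    "\<forall>u. (\<Sum>i = 1..r. of_int (u i) * b i) = 0 \<longrightarrow> (\<forall>i\<in>{1..r}. even (u i))"
    using exists_independent[of r] by auto
  interpret binary_basis K r b
    by unfold_locales (use b in auto)
  show ?thesis
    using finite_points points_nonempty card_points_le points_diff
    by (intro exI[of _ "points n"]) blast
qed

section \<open>Difference sizes of products of cyclic 2-groups\<close>

lemma difference_size_le:
  "finite B \<Longrightarrow> difference_basis G A B \<Longrightarrow> difference_size G A \<le> card B"
  unfolding difference_size_def by (rule Least_le) blast

lemma (in group) exists_minimal_difference_basis:
  assumes "finite (carrier G)"
  shows "\<exists>B. finite B \<and> difference_basis G (carrier G) B \<and> card B = group_difference_size G"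
proof -
  have "difference_basis G (carrier G) (carrier G)"
    unfolding difference_basis_def
  proof (intro conjI ballI)
    fix a assume "a \<in> carrier G"
    then show "\<exists>x\<in>carrier G. \<exists>y\<in>carrier G. a = x \<otimes> inv y"
      by (intro bexI[of _ a] bexI[of _ \<one>]) auto
  qed simp
  then have "\<exists>n B. finite B \<and> difference_basis G (carrier G) B \<and> card B = n"
    using assms by blast
  then show ?thesis
    unfolding difference_size_def by (rule LeastI_ex)
qed

text \<open>An isomorphism maps a minimal difference basis to a difference basis. This transports
  bounds between nested direct products and a single indexed product.\<close>

lemma group_difference_size_iso_le:
  assumes "group G" "group H" and iso: "G \<cong> H" and fin: "finite (carrier G)"
  shows "group_difference_size H \<le> group_difference_size G"
proof -
  obtain h where h: "h \<in> hom G H" "bij_betw h (carrier G) (carrier H)"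
    using iso by (auto simp: is_iso_def iso_def)
  interpret group_hom G H h
    using assms h by (simp add: group_hom_def group_hom_axioms_def)
  obtain B where B: "finite B" "difference_basis G (carrier G) B"
    "card B = group_difference_size G"
    using G.exists_minimal_difference_basis[OF fin] by blast
  have sub: "B \<subseteq> carrier G" using B by (simp add: difference_basis_def)
  have "difference_basis H (carrier H) (h ` B)"
    unfolding difference_basis_def
  proof (intro conjI ballI)
    show "h ` B \<subseteq> carrier H" using sub by auto
    fix a assume "a \<in> carrier H"
    then obtain g where g: "g \<in> carrier G" "a = h g"
      using h(2) by (auto simp: bij_betw_def)
    then obtain x y where xy: "x \<in> B" "y \<in> B" "g = x \<otimes>\<^bsub>G\<^esub> inv\<^bsub>G\<^esub> y"
      using B(2) unfolding difference_basis_def by blast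
    then have "a = h x \<otimes>\<^bsub>H\<^esub> inv\<^bsub>H\<^esub> h y" using g sub by (auto simp: subset_iff)
    then show "\<exists>x\<in>h ` B. \<exists>y\<in>h ` B. a = x \<otimes>\<^bsub>H\<^esub> inv\<^bsub>H\<^esub> y" using xy by blast
  qed
  then have "group_difference_size H \<le> card (h ` B)"
    using B(1) by (intro difference_size_le) auto
  also have "\<dots> \<le> card B" using B(1) by (rule card_image_le)
  finally show ?thesis using B by simp
qed

section \<open>Products of cyclic 2-groups in terms of integer vectors and congruences\<close>

lemma carrier_cyclic2_prod: "carrier (cyclic2_prod I e) = PiE I (\<lambda>i. {0..<2 ^ e i})"
  by (simp add: cyclic2_prod_def carrier_integer_mod_group)

lemma mult_cyclic2_prod:
  "x \<otimes>\<^bsub>cyclic2_prod I e\<^esub> y = (\<lambda>i\<in>I. (x i + y i) mod 2 ^ e i)"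
  by (simp add: cyclic2_prod_def)

lemma group_cyclic2_prod: "group (cyclic2_prod I e)"
  by (simp add: cyclic2_prod_def)

lemma finite_carrier_cyclic2_prod: "finite I \<Longrightarrow> finite (carrier (cyclic2_prod I e))"
  by (simp add: carrier_cyclic2_prod finite_PiE)

lemma card_carrier_cyclic2_prod: "finite I \<Longrightarrow> card (carrier (cyclic2_prod I e)) = 2 ^ sum e I"
  by (simp add: carrier_cyclic2_prod card_PiE nat_power_eq power_sum)

lemma cyclic2_prod_cong:
  assumes "\<And>i. i \<in> I \<Longrightarrow> e i = e' i"
  shows "cyclic2_prod I e = cyclic2_prod I e'"
  using assms unfolding cyclic2_prod_def product_group_def by (simp cong: PiE_cong restrict_cong)

lemma diff_cyclic2_prod:
  assumes "y \<in> carrier (cyclic2_prod I e)"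
  shows "x \<otimes>\<^bsub>cyclic2_prod I e\<^esub> inv\<^bsub>cyclic2_prod I e\<^esub> y = (\<lambda>i\<in>I. (x i - y i) mod 2 ^ e i)"
proof -
  have "inv\<^bsub>cyclic2_prod I e\<^esub> y = (\<lambda>i\<in>I. (- y i) mod 2 ^ e i)"
    using assms unfolding cyclic2_prod_def
    by (subst inv_product_group) (auto intro!: restrict_ext simp: PiE_iff)
  then show ?thesis
    by (auto simp: mult_cyclic2_prod mod_simps intro!: restrict_ext)
qed

lemma cyclic2_prod_Un_iso:
  assumes "I \<inter> J = {}"
  shows "cyclic2_prod I e \<times>\<times> cyclic2_prod J e' \<cong> cyclic2_prod (I \<union> J) (\<lambda>i. if i \<in> I then e i else e' i)"
proof (rule is_isoI, rule isoI)
  let ?h = "\<lambda>(x, y). \<lambda>i\<in>I \<union> J. if i \<in> I then x i else y i :: int"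
  let ?P = "cyclic2_prod I e \<times>\<times> cyclic2_prod J e'"
  let ?Q = "cyclic2_prod (I \<union> J) (\<lambda>i. if i \<in> I then e i else e' i)"
  show "?h \<in> hom ?P ?Q"
  proof (rule homI)
    show "?h p \<in> carrier ?Q" if "p \<in> carrier ?P" for p
      using that by (cases p) (auto simp: carrier_cyclic2_prod PiE_iff)
    show "?h (p \<otimes>\<^bsub>?P\<^esub> q) = ?h p \<otimes>\<^bsub>?Q\<^esub> ?h q" for p q
      by (cases p; cases q) (auto simp: mult_cyclic2_prod fun_eq_iff)
  qed
  show "bij_betw ?h (carrier ?P) (carrier ?Q)"
  proof (rule bij_betw_byWitness[where f' = "\<lambda>z. (restrict z I, restrict z J)"])
    show "\<forall>p\<in>carrier ?P. (restrict (?h p) I, restrict (?h p) J) = p"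
    proof
      fix p assume p: "p \<in> carrier ?P"
      obtain x y where xy: "p = (x, y)" by (cases p)
      with p have x: "x \<in> extensional I" and y: "y \<in> extensional J"
        by (auto simp: carrier_cyclic2_prod PiE_iff)
      have "restrict (?h (x, y)) I = x"
        using x by (auto simp: fun_eq_iff extensional_def)
      moreover have "restrict (?h (x, y)) J = y"
        using y assms by (auto simp: fun_eq_iff extensional_def)
      ultimately show "(restrict (?h p) I, restrict (?h p) J) = p"
        by (simp add: xy)
    qed
    show "\<forall>z\<in>carrier ?Q. ?h (restrict z I, restrict z J) = z"
      by (auto simp: carrier_cyclic2_prod PiE_iff extensional_def fun_eq_iff)
    show "?h ` carrier ?P \<subseteq> carrier ?Q"
      by (auto simp: carrier_cyclic2_prod PiE_iff)
    show "(\<lambda>z. (restrict z I, restrict z J)) ` carrier ?Q \<subseteq> carrier ?P"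
    proof (rule image_subsetI)
      fix z assume "z \<in> carrier ?Q"
      then have z: "z i \<in> {0..<2 ^ (if i \<in> I then e i else e' i)}" if "i \<in> I \<union> J" for i
        using that by (simp add: carrier_cyclic2_prod PiE_iff)
      have "restrict z I \<in> carrier (cyclic2_prod I e)"
        unfolding carrier_cyclic2_prod using z by fastforce
      moreover have "restrict z J \<in> carrier (cyclic2_prod J e')"
        unfolding carrier_cyclic2_prod
      proof (rule restrict_PiE_iff[THEN iffD2], rule ballI)
        fix i assume "i \<in> J"
        then show "z i \<in> {0..<2 ^ e' i}" using z[of i] assms by (auto split: if_splits)
      qed
      ultimately show "(restrict z I, restrict z J) \<in> carrier ?P" by simp
    qed
  qed
qed

text \<open>Passing to arbitrary integer vectors removes reduced representatives and extensionality
  from the covering argument; \<open>difference_size_le_int_basis\<close> leads back.\<close>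

lemma exists_int_basis:
  assumes "finite I"
  shows "\<exists>D. finite D \<and> card D = group_difference_size (cyclic2_prod I e) \<and>
    (\<forall>a::nat \<Rightarrow> int. \<exists>x\<in>D. \<exists>y\<in>D. \<forall>i\<in>I. [a i = x i - y i] (mod 2 ^ e i))"
proof -
  let ?G = "cyclic2_prod I e"
  obtain B where B: "finite B" "difference_basis ?G (carrier ?G) B"
    "card B = group_difference_size ?G"
    using group.exists_minimal_difference_basis[OF group_cyclic2_prod
        finite_carrier_cyclic2_prod[OF assms]] by blast
  have "\<exists>x\<in>B. \<exists>y\<in>B. \<forall>i\<in>I. [a i = x i - y i] (mod 2 ^ e i)" for a
  proof -
    have "(\<lambda>i\<in>I. a i mod 2 ^ e i) \<in> carrier ?G" by (auto simp: carrier_cyclic2_prod)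
    then obtain x y where xy: "x \<in> B" "y \<in> B"
      "(\<lambda>i\<in>I. a i mod 2 ^ e i) = x \<otimes>\<^bsub>?G\<^esub> inv\<^bsub>?G\<^esub> y"
      using B(2) unfolding difference_basis_def by blast
    moreover have "y \<in> carrier ?G" using xy B(2) by (auto simp: difference_basis_def)
    ultimately have eq: "(\<lambda>i\<in>I. a i mod 2 ^ e i) = (\<lambda>i\<in>I. (x i - y i) mod 2 ^ e i)"
      by (simp add: diff_cyclic2_prod)
    have "[a i = x i - y i] (mod 2 ^ e i)" if "i \<in> I" for i
      using fun_cong[OF eq, of i] that by (simp add: cong_def)
    then show ?thesis using xy by blast
  qed
  then show ?thesis using B by blast
qed

text \<open>Reducing the vectors of \<open>D\<close> modulo the orders of the factors can merge some
  of them but never adds any.\<close>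

lemma difference_size_le_int_basis:
  fixes D :: "(nat \<Rightarrow> int) set"
  assumes "finite D" and D: "\<And>a. \<exists>x\<in>D. \<exists>y\<in>D. \<forall>i\<in>I. [a i = x i - y i] (mod 2 ^ e i)"
  shows "group_difference_size (cyclic2_prod I e) \<le> card D"
proof -
  let ?G = "cyclic2_prod I e"
  let ?red = "\<lambda>x. \<lambda>i\<in>I. x i mod 2 ^ e i"
  have mem: "?red x \<in> carrier ?G" for x
    by (auto simp: carrier_cyclic2_prod)
  have "difference_basis ?G (carrier ?G) (?red ` D)"
    unfolding difference_basis_def
  proof (intro conjI ballI)
    show "?red ` D \<subseteq> carrier ?G" using mem by blast
    fix a assume a: "a \<in> carrier ?G"
    obtain x y where xy: "x \<in> D" "y \<in> D" "\<forall>i\<in>I. [a i = x i - y i] (mod 2 ^ e i)"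
      using D by blast
    have "a = ?red a"
      using a by (auto simp: carrier_cyclic2_prod PiE_iff extensional_def fun_eq_iff)
    also have "\<dots> = ?red x \<otimes>\<^bsub>?G\<^esub> inv\<^bsub>?G\<^esub> ?red y"
      unfolding diff_cyclic2_prod[OF mem]
      using xy(3) by (auto simp: cong_def mod_simps intro!: restrict_ext)
    finally show "\<exists>x\<in>?red ` D. \<exists>y\<in>?red ` D. a = x \<otimes>\<^bsub>?G\<^esub> inv\<^bsub>?G\<^esub> y"
      using xy by blast
  qed
  then have "group_difference_size ?G \<le> card (?red ` D)"
    using assms(1) by (intro difference_size_le) auto
  then show ?thesis using card_image_le[OF assms(1), of ?red] by linarith
qed

lemma cong_scaled:
  fixes a b x :: int
  assumes "a = b + 2 ^ c * q" "[q = x] (mod 2 ^ f)"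
  shows "[a = b + 2 ^ c * x] (mod 2 ^ (c + f))"
proof -
  have "a - (b + 2 ^ c * x) = 2 ^ c * (q - x)" by (simp add: assms(1) algebra_simps)
  moreover have "2 ^ c * 2 ^ f dvd 2 ^ c * (q - x)"
    using assms(2) by (intro mult_dvd_mono dvd_refl) (simp add: cong_iff_dvd_diff)
  ultimately show ?thesis by (simp add: cong_iff_dvd_diff power_add)
qed

text \<open>The exponents \<open>f\<close> and \<open>g\<close> describe the subgroups of multiples
  of \<open>2 ^ c i\<close> and \<open>2 ^ h i\<close>. A vector in the latter is divided by
  \<open>2 ^ h i\<close> and covered through \<open>E\<close>; any other has some
  \<open>s - s'\<close> subtracted, is divided by \<open>2 ^ c i\<close> and covered through
  \<open>D\<close>. The \<open>+ 1\<close> accounts for the element shared by the two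
  pieces.\<close>

lemma group_difference_size_cyclic2_prod_le:
  fixes S :: "(nat \<Rightarrow> int) set"
  assumes I: "finite I" and S: "finite S" "S \<noteq> {}"
    and f: "\<And>i. i \<in> I \<Longrightarrow> e i = c i + f i"
    and g: "\<And>i. i \<in> I \<Longrightarrow> e i = h i + g i"
    and cover: "\<And>a :: nat \<Rightarrow> int. (\<forall>i\<in>I. 2 ^ h i dvd a i) \<or>
      (\<exists>s\<in>S. \<exists>s'\<in>S. \<forall>i\<in>I. [a i = s i - s' i] (mod 2 ^ c i))"
  shows "group_difference_size (cyclic2_prod I e) + 1 \<le>
           card S * group_difference_size (cyclic2_prod I f) + group_difference_size (cyclic2_prod I g)"
proof -
  obtain D where D: "finite D" "card D = group_difference_size (cyclic2_prod I f)"
    "\<And>a :: nat \<Rightarrow> int. \<exists>x\<in>D. \<exists>y\<in>D. \<forall>i\<in>I. [a i = x i - y i] (mod 2 ^ f i)"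
    using exists_int_basis[OF I, of f] by metis
  obtain E where E: "finite E" "card E = group_difference_size (cyclic2_prod I g)"
    "\<And>a :: nat \<Rightarrow> int. \<exists>x\<in>E. \<exists>y\<in>E. \<forall>i\<in>I. [a i = x i - y i] (mod 2 ^ g i)"
    using exists_int_basis[OF I, of g] by metis
  obtain s0 d0 e0 where s0: "s0 \<in> S" and d0: "d0 \<in> D" and e0: "e0 \<in> E"
    using S D(3)[of "\<lambda>_. 0"] E(3)[of "\<lambda>_. 0"] by blast
  \<comment> \<open>The second basis is translated so that it meets the first, which saves one element.\<close>
  define u where "u = (\<lambda>(s :: nat \<Rightarrow> int, d :: nat \<Rightarrow> int) i. s i + 2 ^ c i * d i)"
  define v where "v = (\<lambda>d i. u (s0, d0) i + 2 ^ h i * (d i - e0 i))"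
  have common: "u (s0, d0) \<in> u ` (S \<times> D) \<inter> v ` E"
  proof -
    have "u (s0, d0) = v e0" by (simp add: v_def fun_eq_iff)
    then show ?thesis using s0 d0 e0 by blast
  qed
  have fin: "finite (u ` (S \<times> D))" "finite (v ` E)" using S D E by auto
  have "card (u ` (S \<times> D)) \<le> card S * card D"
    using card_image_le[of "S \<times> D" u] S D by (simp add: card_cartesian_product)
  moreover have "card (v ` E) \<le> card E" using E(1) by (rule card_image_le)
  moreover have "card (u ` (S \<times> D) \<inter> v ` E) \<ge> 1"
    using common fin by (metis One_nat_def Suc_leI card_gt_0_iff empty_iff finite_Int)
  ultimately have card: "card (u ` (S \<times> D) \<union> v ` E) + 1 \<le> card S * card D + card E"
    using card_Un_Int[OF fin] by linarith
  have "\<exists>x\<in>u ` (S \<times> D) \<union> v ` E. \<exists>y\<in>u ` (S \<times> D) \<union> v ` E. \<forall>i\<in>I. [a i = x i - y i] (mod 2 ^ e i)"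
    for a :: "nat \<Rightarrow> int"
    using cover[of a]
  proof
    assume dvd: "\<forall>i\<in>I. 2 ^ h i dvd a i"
    obtain x y where xy: "x \<in> E" "y \<in> E" "\<forall>i\<in>I. [a i div 2 ^ h i = x i - y i] (mod 2 ^ g i)"
      using E(3)[of "\<lambda>i. a i div 2 ^ h i"] by blast
    have "[a i = v x i - v y i] (mod 2 ^ e i)" if i: "i \<in> I" for i
    proof -
      have "[a i = 0 + 2 ^ h i * (x i - y i)] (mod 2 ^ (h i + g i))"
        by (rule cong_scaled[of _ _ _ "a i div 2 ^ h i"]) (use dvd xy i in auto)
      then show ?thesis using g[OF i] by (simp add: v_def algebra_simps)
    qed
    then show ?thesis using xy by blast
  next
    assume "\<exists>s\<in>S. \<exists>s'\<in>S. \<forall>i\<in>I. [a i = s i - s' i] (mod 2 ^ c i)"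
    then obtain s s' where s: "s \<in> S" "s' \<in> S" "\<forall>i\<in>I. [a i = s i - s' i] (mod 2 ^ c i)"
      by blast
    obtain x y where xy: "x \<in> D" "y \<in> D"
      "\<forall>i\<in>I. [(a i - (s i - s' i)) div 2 ^ c i = x i - y i] (mod 2 ^ f i)"
      using D(3)[of "\<lambda>i. (a i - (s i - s' i)) div 2 ^ c i"] by blast
    have "[a i = u (s, x) i - u (s', y) i] (mod 2 ^ e i)" if i: "i \<in> I" for i
    proof -
      have "[a i = (s i - s' i) + 2 ^ c i * (x i - y i)] (mod 2 ^ (c i + f i))"
        by (rule cong_scaled[of _ _ _ "(a i - (s i - s' i)) div 2 ^ c i"])
          (use s xy i in \<open>auto simp: cong_iff_dvd_diff\<close>)
      then show ?thesis using f[OF i] by (simp add: u_def algebra_simps)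
    qed
    then show ?thesis using s xy by blast
  qed
  then have "group_difference_size (cyclic2_prod I e) \<le> card (u ` (S \<times> D) \<union> v ` E)"
    using fin by (intro difference_size_le_int_basis) auto
  then show ?thesis using card D(2) E(2) by simp
qed


section \<open>The bounds for products of cyclic 2-groups\<close>

theorem theorem7p2:
  fixes ks :: "nat \<Rightarrow> nat" and m k r :: nat
  assumes "k \<ge> 1" and "2 * r \<le> m"
    and "\<forall>i\<in>{1..r}. k + 1 \<le> ks i"
    and "\<forall>i\<in>{r + 1..2 * r}. k - 1 \<le> ks i"
  shows "int (group_difference_size (cyclic2_prod {1..m} ks))
         \<le> int (group_difference_size
               (cyclic2_prod {1..r} (\<lambda>i. ks i - (k + 1))
                \<times>\<times> cyclic2_prod {r + 1..2 * r} (\<lambda>i. ks i - (k - 1))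
                \<times>\<times> cyclic2_prod {2 * r + 1..m} ks)) * 2 ^ (k * r)
           + int (group_difference_size
               (cyclic2_prod {1..r} (\<lambda>i. ks i - 1) \<times>\<times> cyclic2_prod {r + 1..m} ks)) - 1
    \<and> group_difference_char (cyclic2_prod {1..m} ks)
         \<le> group_difference_char
               (cyclic2_prod {1..r} (\<lambda>i. ks i - (k + 1))
                \<times>\<times> cyclic2_prod {r + 1..2 * r} (\<lambda>i. ks i - (k - 1))
                \<times>\<times> cyclic2_prod {2 * r + 1..m} ks)
           + 1 / sqrt (2 ^ r) * group_difference_char
               (cyclic2_prod {1..r} (\<lambda>i. ks i - 1) \<times>\<times> cyclic2_prod {r + 1..m} ks)
           - (\<Prod>i=1..m. 1 / sqrt (2 ^ ks i))"
proof -
  \<comment> \<open>Multiples of \<open>2 ^ c i\<close> form the subgroup \<open>M\<close>, those of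
    \<open>2 ^ h i\<close> the subgroup \<open>H\<close>. Beyond \<open>2 * r\<close> the exponent
    \<open>c i\<close> is 0, so congruences there are trivial.\<close>
  define c where "c = (\<lambda>i. if i \<in> {1..r} then k + 1 else if i \<in> {r + 1..2 * r} then k - 1 else 0)"
  define h where "h = (\<lambda>i. if i \<in> {1..r} then 1 else 0 :: nat)"
  define f where "f = (\<lambda>i. ks i - c i)"
  define g where "g = (\<lambda>i. ks i - h i)"
  \<comment> \<open>The lower bounds on \<open>ks\<close> make the truncated subtractions
    exact.\<close>
  have ks_c: "ks i = c i + f i" and ks_h: "ks i = h i + g i" for i
    using assms(3)[rule_format, of i] assms(4)[rule_format, of i]
    by (auto simp: c_def f_def h_def g_def)
  let ?G = "cyclic2_prod {1..m} ks"
  let ?A = "cyclic2_prod {1..r} (\<lambda>i. ks i - (k + 1))"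
  let ?B = "cyclic2_prod {r + 1..2 * r} (\<lambda>i. ks i - (k - 1))"
  let ?C = "cyclic2_prod {2 * r + 1..m} ks"
  let ?M = "?A \<times>\<times> ?B \<times>\<times> ?C"
  let ?A' = "cyclic2_prod {1..r} (\<lambda>i. ks i - 1)"
  let ?C' = "cyclic2_prod {r + 1..m} ks"
  let ?H = "?A' \<times>\<times> ?C'"
  have groups: "group ?M" "group ?H"
    by (intro DirProd_group group_cyclic2_prod)+
  have finite: "finite (carrier ?M)" "finite (carrier ?H)"
    by (simp_all add: finite_carrier_cyclic2_prod)

  \<comment> \<open>The blocks are glued one after the other into a single product over
    \<open>{1..m}\<close> with exponents \<open>f\<close>.\<close>
  have "?B \<times>\<times> ?C \<cong> cyclic2_prod ({r + 1..2 * r} \<union> {2 * r + 1..m})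
          (\<lambda>i. if i \<in> {r + 1..2 * r} then ks i - (k - 1) else ks i)"
    by (rule cyclic2_prod_Un_iso) auto
  also have "{r + 1..2 * r} \<union> {2 * r + 1..m} = {r + 1..m}"
    using assms(2) by auto
  finally have "?M \<cong> ?A \<times>\<times> cyclic2_prod {r + 1..m}
          (\<lambda>i. if i \<in> {r + 1..2 * r} then ks i - (k - 1) else ks i)"
    by (rule group.DirProd_iso_trans[OF group_cyclic2_prod iso_refl])
  also have "\<dots> \<cong> cyclic2_prod ({1..r} \<union> {r + 1..m}) (\<lambda>i. if i \<in> {1..r} then ks i - (k + 1)
          else if i \<in> {r + 1..2 * r} then ks i - (k - 1) else ks i)"
    by (rule cyclic2_prod_Un_iso) auto
  also have "{1..r} \<union> {r + 1..m} = {1..m}" using assms(2) by auto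
  also have "cyclic2_prod {1..m} (\<lambda>i. if i \<in> {1..r} then ks i - (k + 1)
          else if i \<in> {r + 1..2 * r} then ks i - (k - 1) else ks i) = cyclic2_prod {1..m} f"
    by (rule cyclic2_prod_cong) (simp add: f_def c_def)
  finally have isoM: "?M \<cong> cyclic2_prod {1..m} f" .

  have "?H \<cong> cyclic2_prod ({1..r} \<union> {r + 1..m}) (\<lambda>i. if i \<in> {1..r} then ks i - 1 else ks i)"
    by (rule cyclic2_prod_Un_iso) auto
  also have "{1..r} \<union> {r + 1..m} = {1..m}" using assms(2) by auto
  also have "cyclic2_prod {1..m} (\<lambda>i. if i \<in> {1..r} then ks i - 1 else ks i) = cyclic2_prod {1..m} g"
    by (rule cyclic2_prod_cong) (simp add: g_def h_def)
  finally have isoH: "?H \<cong> cyclic2_prod {1..m} g" .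

  obtain S :: "(nat \<Rightarrow> int) set" where S: "finite S" "S \<noteq> {}" and "card S \<le> 2 ^ (Suc (k - 1) * r)"
    and diff: "\<And>a i. i \<in> {1..r} \<Longrightarrow> odd (a i) \<Longrightarrow> \<exists>s\<in>S. \<exists>s'\<in>S.
        (\<forall>i\<in>{1..r}. [a i = s i - s' i] (mod 2 ^ (k - 1 + 2))) \<and>
        (\<forall>i\<in>{r + 1..2 * r}. [a i = s i - s' i] (mod 2 ^ (k - 1)))"
    using exists_relative_difference_set[of "k - 1" r] by (elim exE conjE) blast
  then have card_S: "card S \<le> 2 ^ (k * r)" using assms(1) by simp
  \<comment> \<open>With \<open>k \<ge> 1\<close> the truncated \<open>k - 1\<close> is exact, which
    gives the modulus \<open>2 ^ (k + 1)\<close> on the first block.\<close>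
  have "k - 1 + 2 = k + 1" using assms(1) by simp
  note diff = diff[unfolded this]
  have cover: "(\<forall>i\<in>{1..m}. 2 ^ h i dvd a i) \<or>
      (\<exists>s\<in>S. \<exists>s'\<in>S. \<forall>i\<in>{1..m}. [a i = s i - s' i] (mod 2 ^ c i))" for a :: "nat \<Rightarrow> int"
  proof (cases "\<exists>i\<in>{1..r}. odd (a i)")
    case True
    then obtain s s' where s: "s \<in> S" "s' \<in> S"
      "\<forall>i\<in>{1..r}. [a i = s i - s' i] (mod 2 ^ (k + 1))"
      "\<forall>i\<in>{r + 1..2 * r}. [a i = s i - s' i] (mod 2 ^ (k - 1))"
      using diff by blast
    then have "\<forall>i\<in>{1..m}. [a i = s i - s' i] (mod 2 ^ c i)" by (simp add: c_def)
    then show ?thesis using s by blast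
  qed (auto simp: h_def)

  have "group_difference_size ?G + 1 \<le>
          card S * group_difference_size (cyclic2_prod {1..m} f)
          + group_difference_size (cyclic2_prod {1..m} g)"
    using S ks_c ks_h cover by (intro group_difference_size_cyclic2_prod_le) auto
  also have "\<dots> \<le> 2 ^ (k * r) * group_difference_size ?M + group_difference_size ?H"
    using card_S group_difference_size_iso_le[OF groups(1) group_cyclic2_prod isoM finite(1)]
      group_difference_size_iso_le[OF groups(2) group_cyclic2_prod isoH finite(2)]
    by (intro add_mono mult_mono) auto
  finally have main: "group_difference_size ?G + 1
      \<le> 2 ^ (k * r) * group_difference_size ?M + group_difference_size ?H" .
  then have "int (group_difference_size ?G + 1)
      \<le> int (2 ^ (k * r) * group_difference_size ?M + group_difference_size ?H)"
    by (simp only: of_nat_le_iff)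
  then have part1: "int (group_difference_size ?G)
      \<le> int (group_difference_size ?M) * 2 ^ (k * r) + int (group_difference_size ?H) - 1"
    by (simp add: mult.commute)

  have split: "sum w {1..m} = sum w {1..r} + sum w {r + 1..2 * r} + sum w {2 * r + 1..m}"
    for w :: "nat \<Rightarrow> nat"
    using sum.ub_add_nat[of 1 r w "r + (m - 2 * r)"] sum.ub_add_nat[of "r + 1" "2 * r" w "m - 2 * r"]
      assms(2) by (simp add: mult_2)
  have "sum c {1..r} = r * (k + 1)" "sum c {r + 1..2 * r} = r * (k - 1)" "sum c {2 * r + 1..m} = 0"
    by (simp_all add: c_def)
  then have "sum c {1..m} = r * ((k + 1) + (k - 1))"
    by (simp only: split add_0_right distrib_left)
  \<comment> \<open>The exponents \<open>k + 1\<close> and \<open>k - 1\<close> average to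
    \<open>k\<close>. So \<open>M\<close> has index \<open>2 ^ (2 * (k * r))\<close>, whose square
    root is exactly the factor in front of the difference size of \<open>M\<close>.\<close>
  then have sum_c: "sum c {1..m} = 2 * (k * r)" using assms(1) by simp
  have "sum h {1..r} = r" "sum h {r + 1..2 * r} = 0" "sum h {2 * r + 1..m} = 0"
    by (simp_all add: h_def)
  then have sum_h: "sum h {1..m} = r" by (simp only: split)
  define N where "N = sum ks {1..m}"
  have N_f: "N = 2 * (k * r) + sum f {1..m}"
    using sum.distrib[of c f "{1..m}"] sum_c by (simp add: N_def flip: ks_c)
  have N_g: "N = r + sum g {1..m}"
    using sum.distrib[of h g "{1..m}"] sum_h by (simp add: N_def flip: ks_h)
  have card_M: "card (carrier ?M) = 2 ^ sum f {1..m}" and card_H: "card (carrier ?H) = 2 ^ sum g {1..m}"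
    using iso_same_card[OF isoM] iso_same_card[OF isoH] by (simp_all only: card_carrier_cyclic2_prod finite_atLeastAtMost)
  have sqrt_M: "sqrt (2 ^ N) = 2 ^ (k * r) * sqrt (2 ^ sum f {1..m})"
    unfolding N_f by (simp add: power_add real_sqrt_mult real_sqrt_power power_mult)
  have sqrt_H: "sqrt (2 ^ N) = sqrt (2 ^ r) * sqrt (2 ^ sum g {1..m})"
    unfolding N_g by (simp add: power_add real_sqrt_mult)
  have prod: "(\<Prod>i=1..m. 1 / sqrt (2 ^ ks i)) = 1 / sqrt (2 ^ N)"
  proof -
    have "(\<Prod>i\<in>I. 1 / sqrt (2 ^ ks i)) = 1 / sqrt (2 ^ sum ks I)" if "finite I" for I
      using that by (induction I rule: finite_induct) (simp_all add: power_add real_sqrt_mult)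
    then show ?thesis by (simp add: N_def)
  qed
  have char_G: "group_difference_char ?G = real (group_difference_size ?G) / sqrt (2 ^ N)"
    by (simp add: difference_char_def card_carrier_cyclic2_prod N_def)
  have char_M: "group_difference_char ?M = real (group_difference_size ?M) * 2 ^ (k * r) / sqrt (2 ^ N)"
    unfolding difference_char_def card_M sqrt_M by simp
  have char_H: "1 / sqrt (2 ^ r) * group_difference_char ?H = real (group_difference_size ?H) / sqrt (2 ^ N)"
    unfolding difference_char_def card_H sqrt_H by simp
  have "real (group_difference_size ?G)
      \<le> real (group_difference_size ?M) * 2 ^ (k * r) + real (group_difference_size ?H) - 1"
    using of_nat_mono[OF main, where 'a = real] by (simp add: mult.commute)
  \<comment> \<open>After division by \<open>sqrt (2 ^ N)\<close>, the one saved element becomes the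
    subtracted product.\<close>
  then have "real (group_difference_size ?G) / sqrt (2 ^ N)
      \<le> (real (group_difference_size ?M) * 2 ^ (k * r) + real (group_difference_size ?H) - 1) / sqrt (2 ^ N)"
    by (intro divide_right_mono) auto
  then have "group_difference_char ?G \<le> group_difference_char ?M
      + 1 / sqrt (2 ^ r) * group_difference_char ?H - (\<Prod>i=1..m. 1 / sqrt (2 ^ ks i))"
    unfolding char_G char_M char_H prod by (simp only: add_divide_distrib diff_divide_distrib)
  with part1 show ?thesis by blast
qed

end
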